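(* Let $f$ be $g$-convex on an interval $J$ and let $A\in\mathcal{B}(\mathcal{H})$ be self-adjoint with spectrum contained in $J$. If $x\in\mathcal{H}$ is a unit vector, then $$f\left(\langle Ax,x\rangle\right)\le g^{-1}\left(\langle (g\circ f)(A)x,x\rangle\right)\le \langle f(A)x,x\rangle.$$
   Context: $\mathcal{B}(\mathcal{H})$ is the $C^*$-algebra of bounded linear operators on a complex Hilbert space $\mathcal{H}$, and functions of self-adjoint operators are defined by the continuous functional calculus. Let $J,J_2,J_3\subseteq\mathbb{R}$ be intervals. A continuous function $f:J\to J_2$ is called $g$-convex on $J$ if $g:J_2\to J_3$ is (strictly) increasing and concave on $J_2$ and $g\circ f:J\to J_3$ is convex. $g^{-1}$ denotes the inverse of $g$, defined on $g(J_2)$. *)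

theory Defs
  imports "HOL-Analysis.Analysis"
begin

text \<open>
  Complex Hilbert spaces. The underlying real normed space is the library one, and completeness
  is that of the library; the complex scalar multiplication must extend the real one and
  the inner product must induce the norm. The inner product is linear in its first argument.
  The law \<open>1 *\<^sub>C x = x\<close> and the positive definiteness of the inner product follow from
  \<open>scaleC_of_real\<close> and \<open>cinner_self\<close>.
\<close>

class complex_inner = real_normed_vector +
  fixes scaleC :: "complex \<Rightarrow> 'a \<Rightarrow> 'a"  (infixr "*\<^sub>C" 75)
    and cinner :: "'a \<Rightarrow> 'a \<Rightarrow> complex"
  assumes scaleC_add_right: "a *\<^sub>C (x + y) = a *\<^sub>C x + a *\<^sub>C y"
    and scaleC_add_left: "(a + b) *\<^sub>C x = a *\<^sub>C x + b *\<^sub>C x"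
    and scaleC_scaleC: "a *\<^sub>C b *\<^sub>C x = (a * b) *\<^sub>C x"
    and scaleC_of_real: "complex_of_real r *\<^sub>C x = r *\<^sub>R x"
    and cinner_add_left: "cinner (x + y) z = cinner x z + cinner y z"
    and cinner_scaleC_left: "cinner (a *\<^sub>C x) y = a * cinner x y"
    and cinner_commute: "cinner y x = cnj (cinner x y)"
    and cinner_self: "cinner x x = complex_of_real ((norm x)\<^sup>2)"

class chilbert_space = complex_inner + complete_space

text \<open>
  The algebra of bounded operators: the library type of bounded linear maps only records
  real linearity, so complex homogeneity is imposed separately.
\<close>

definition bounded_ops :: "('a::chilbert_space \<Rightarrow>\<^sub>L 'a) set" where
  "bounded_ops = {T. \<forall>c x. blinfun_apply T (c *\<^sub>C x) = c *\<^sub>C blinfun_apply T x}"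

definition adjoint_pair :: "('a::chilbert_space \<Rightarrow>\<^sub>L 'a) \<Rightarrow> ('a \<Rightarrow>\<^sub>L 'a) \<Rightarrow> bool" where
  "adjoint_pair S T \<longleftrightarrow> (\<forall>x y. cinner (blinfun_apply S x) y = cinner x (blinfun_apply T y))"

definition self_adjoint :: "('a::chilbert_space \<Rightarrow>\<^sub>L 'a) \<Rightarrow> bool" where
  "self_adjoint A \<longleftrightarrow> adjoint_pair A A"

definition op_spectrum :: "('a::chilbert_space \<Rightarrow>\<^sub>L 'a) \<Rightarrow> complex set" where
  "op_spectrum A = {z. \<not> (\<exists>S\<in>bounded_ops.
     (\<forall>x. blinfun_apply S (blinfun_apply A x - z *\<^sub>C x) = x) \<and>
     (\<forall>x. blinfun_apply A (blinfun_apply S x) - z *\<^sub>C blinfun_apply S x = x))}"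

text \<open>
  A continuous functional calculus for \<open>A\<close>: a unital *-homomorphism from the algebra of
  continuous complex functions on the spectrum into the bounded operators that sends the identity
  function to \<open>A\<close>. Elements of the function algebra are represented by total functions that
  are continuous on the spectrum, two of them being identified if they agree there.
\<close>

definition is_functional_calculus ::
  "('a::chilbert_space \<Rightarrow>\<^sub>L 'a) \<Rightarrow> ((complex \<Rightarrow> complex) \<Rightarrow> ('a \<Rightarrow>\<^sub>L 'a)) \<Rightarrow> bool" where
  "is_functional_calculus A \<Phi> \<longleftrightarrow>
     (let C = {u. continuous_on (op_spectrum A) u} in
       (\<forall>u\<in>C. \<Phi> u \<in> bounded_ops) \<and>
       (\<forall>u\<in>C. \<forall>v\<in>C. (\<forall>z\<in>op_spectrum A. u z = v z) \<longrightarrow> \<Phi> u = \<Phi> v) \<and>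
       (\<forall>u\<in>C. \<forall>v\<in>C. \<Phi> (\<lambda>z. u z + v z) = \<Phi> u + \<Phi> v) \<and>
       (\<forall>c. \<forall>u\<in>C. \<forall>x. blinfun_apply (\<Phi> (\<lambda>z. c * u z)) x = c *\<^sub>C blinfun_apply (\<Phi> u) x) \<and>
       (\<forall>u\<in>C. \<forall>v\<in>C. \<Phi> (\<lambda>z. u z * v z) = \<Phi> u o\<^sub>L \<Phi> v) \<and>
       (\<forall>u\<in>C. adjoint_pair (\<Phi> u) (\<Phi> (\<lambda>z. cnj (u z)))) \<and>
       \<Phi> (\<lambda>z. 1) = id_blinfun \<and>
       \<Phi> (\<lambda>z. z) = A)"

text \<open>
  For self-adjoint \<open>A\<close> such a calculus exists, and its values on functions that are continuous on
  the spectrum are unique (continuity being automatic for *-homomorphisms), so the choice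
  below is immaterial for those functions.
\<close>

definition functional_calculus ::
  "('a::chilbert_space \<Rightarrow>\<^sub>L 'a) \<Rightarrow> (complex \<Rightarrow> complex) \<Rightarrow> ('a \<Rightarrow>\<^sub>L 'a)" where
  "functional_calculus A = (SOME \<Phi>. is_functional_calculus A \<Phi>)"

text \<open>
  \<open>f(A)\<close> for a real function \<open>f\<close>. The spectrum of a self-adjoint operator is real, so precomposing
  with \<open>Re\<close> only extends \<open>f\<close> beyond the spectrum.
\<close>

definition fun_of_op :: "(real \<Rightarrow> real) \<Rightarrow> ('a::chilbert_space \<Rightarrow>\<^sub>L 'a) \<Rightarrow> ('a \<Rightarrow>\<^sub>L 'a)" where
  "fun_of_op f A = functional_calculus A (\<lambda>z. complex_of_real (f (Re z)))"

definition g_convex_on ::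
  "(real \<Rightarrow> real) \<Rightarrow> real set \<Rightarrow> real set \<Rightarrow> real set \<Rightarrow> (real \<Rightarrow> real) \<Rightarrow> bool" where
  "g_convex_on g J J2 J3 f \<longleftrightarrow>
     is_interval J \<and> is_interval J2 \<and> is_interval J3 \<and>
     continuous_on J f \<and> f ` J \<subseteq> J2 \<and>
     g ` J2 \<subseteq> J3 \<and> strict_mono_on J2 g \<and> concave_on J2 g \<and>
     convex_on J (g \<circ> f)"

end

(*
  A polynomial with q(A) self-adjoint takes on the spectrum of A a real value below <q(A)y, y>, for
  each unit vector y: the infimum m of the numerical range of q(A) makes q(A) - m non-invertible,
  and factoring q - m over the complex numbers puts one of its roots into the spectrum. Applied to
  -cnj(p) p this bounds norm (p(A)) by the supremum of |p| on the spectrum, so that p |-> p(A)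
  extends by Weierstrass approximation to a functional calculus. Taking square roots, any calculus
  is positive, so u |-> <u(A)x, x> is a positive normalized functional E. It takes each continuous u
  to a value of u, so E(g o f) = g(f(t)) for some t in J, and f(t) is the middle term. Jensen's
  inequality for the convex g o f and the concave g, obtained from supporting lines, then gives
  f(E(id)) <= f(t) <= E(f).
*)

theory Submission
  imports Defs "HOL-Computational_Algebra.Fundamental_Theorem_Algebra"
begin

subsection \<open>Operators on a complex Hilbert space\<close>

text \<open>\<open>functional_calculus\<close> is a choice, about which nothing is known until some
  calculus has been constructed. The later facts are drawn from the axioms in
  \<open>is_functional_calculus\<close> alone, so they hold for whichever calculus is picked. The
  numerical range stands in for spectral radius theory: for a self-adjoint operator it yields both a
  nonempty spectrum and the norm bound for polynomials. The middle term is delicate because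
  \<open>inv_into J2 g\<close> inverts \<open>g\<close> only on the image of \<open>J2\<close>. The
  expectation of \<open>g \<circ> f\<close> has to be located there, by an intermediate value
  argument that calls for continuity of \<open>g \<circ> f\<close>, although \<open>g\<close> itself
  is not assumed continuous.\<close>

instance chilbert_space \<subseteq> banach ..

lemma scaleC_one: "1 *\<^sub>C x = (x :: 'a::complex_inner)"
  using scaleC_of_real[of 1 x] by simp

lemma cinner_add_right: "cinner x (y + z) = cinner x y + cinner x (z :: 'a::complex_inner)"
  by (metis cinner_add_left cinner_commute complex_cnj_add)

lemma cinner_scaleC_right: "cinner x (a *\<^sub>C y) = cnj a * cinner x (y :: 'a::complex_inner)"
  by (metis cinner_scaleC_left cinner_commute complex_cnj_mult)

lemma cinner_scaleR_left: "cinner (r *\<^sub>R x) y = complex_of_real r * cinner x (y :: 'a::complex_inner)"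
  by (metis cinner_scaleC_left scaleC_of_real)

lemma cinner_scaleR_right: "cinner x (r *\<^sub>R y) = complex_of_real r * cinner x (y :: 'a::complex_inner)"
  by (metis cinner_scaleC_right scaleC_of_real complex_cnj_complex_of_real)

lemma cinner_minus_left: "cinner (- x) y = - cinner x (y :: 'a::complex_inner)"
  using cinner_scaleR_left[of "-1" x y] by simp

lemma cinner_minus_right: "cinner x (- y) = - cinner x (y :: 'a::complex_inner)"
  using cinner_scaleR_right[of x "-1" y] by simp

lemma cinner_diff_left: "cinner (x - y) z = cinner x z - cinner y (z :: 'a::complex_inner)"
  using cinner_add_left[of x "- y" z] by (simp add: cinner_minus_left)

lemma cinner_diff_right: "cinner x (y - z) = cinner x y - cinner x (z :: 'a::complex_inner)"
  using cinner_add_right[of x y "- z"] by (simp add: cinner_minus_right)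

lemma cinner_zero_left [simp]: "cinner 0 y = 0" for y :: "'a::complex_inner"
  using cinner_scaleR_left[of 0 0 y] by simp

lemma cinner_zero_right [simp]: "cinner x 0 = 0" for x :: "'a::complex_inner"
  using cinner_scaleR_right[of x 0 0] by simp

lemma Re_cinner_commute: "Re (cinner x y) = Re (cinner y (x :: 'a::complex_inner))"
  by (metis cinner_commute complex_cnj(1) complex.sel(1) complex.collapse)

lemma norm_scaleC: "norm (c *\<^sub>C x) = cmod c * norm (x :: 'a::complex_inner)"
proof -
  have "complex_of_real ((norm (c *\<^sub>C x))\<^sup>2) = complex_of_real ((cmod c * norm x)\<^sup>2)"
    using complex_norm_square[of c]
    by (simp only: cinner_self[symmetric] cinner_scaleC_left cinner_scaleC_right)
      (simp add: cinner_self mult.assoc[symmetric] power_mult_distrib mult.commute[of "cnj c"])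
  then have "(norm (c *\<^sub>C x))\<^sup>2 = (cmod c * norm x)\<^sup>2"
    by (simp only: of_real_eq_iff)
  then show ?thesis by (simp add: power2_eq_iff_nonneg)
qed

text \<open>Since the norm is given by the inner product, the Cauchy--Schwarz inequality for the real
  part is the triangle inequality squared.\<close>

lemma Re_cinner_le: "Re (cinner x y) \<le> norm x * norm (y :: 'a::complex_inner)"
proof -
  have "complex_of_real ((norm (x + y))\<^sup>2)
      = complex_of_real ((norm x)\<^sup>2) + complex_of_real ((norm y)\<^sup>2) + (cinner x y + cinner y x)"
    by (simp only: cinner_self[symmetric] cinner_add_left cinner_add_right) simp
  then have "(norm (x + y))\<^sup>2 = (norm x)\<^sup>2 + (norm y)\<^sup>2 + 2 * Re (cinner x y)"
    using Re_cinner_commute[of x y] by (auto dest!: arg_cong[where f = Re])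
  moreover have "(norm (x + y))\<^sup>2 \<le> (norm x + norm y)\<^sup>2"
    by (simp add: norm_triangle_ineq power_mono)
  ultimately show ?thesis by (simp add: power2_sum)
qed

lemma abs_Re_cinner_le: "\<bar>Re (cinner x y)\<bar> \<le> norm x * norm (y :: 'a::complex_inner)"
  using Re_cinner_le[of x y] Re_cinner_le[of "- x" y] by (simp add: cinner_minus_left abs_le_iff)

lemma bounded_linear_scaleC: "bounded_linear (\<lambda>x::'a::complex_inner. c *\<^sub>C x)"
proof
  show "c *\<^sub>C (r *\<^sub>R x) = r *\<^sub>R (c *\<^sub>C x)" for r and x :: 'a
    by (metis mult.commute scaleC_of_real scaleC_scaleC)
  show "\<exists>K. \<forall>x::'a. norm (c *\<^sub>C x) \<le> norm x * K"
    by (metis norm_scaleC mult.commute order_refl)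
qed (rule scaleC_add_right)

section \<open>Scalar operators and complex-linear operators\<close>

definition scale_op :: "complex \<Rightarrow> 'a::complex_inner \<Rightarrow>\<^sub>L 'a" where
  "scale_op c = Blinfun (\<lambda>x. c *\<^sub>C x)"

lemma scale_op_apply [simp]: "blinfun_apply (scale_op c) x = c *\<^sub>C x"
  by (simp add: scale_op_def bounded_linear_Blinfun_apply bounded_linear_scaleC)

lemma scale_op_add: "scale_op (a + b) = scale_op a + (scale_op b :: 'a::complex_inner \<Rightarrow>\<^sub>L 'a)"
  by (intro blinfun_eqI) (simp add: blinfun.add_left scaleC_add_left)

lemma scale_op_mult: "scale_op (a * b) = scale_op a o\<^sub>L (scale_op b :: 'a::complex_inner \<Rightarrow>\<^sub>L 'a)"
  by (intro blinfun_eqI) (simp add: scaleC_scaleC)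

lemma scale_op_0 [simp]: "scale_op 0 = (0 :: 'a::complex_inner \<Rightarrow>\<^sub>L 'a)"
  by (intro blinfun_eqI) (metis scale_op_apply norm_eq_zero norm_scaleC norm_zero mult_zero_left zero_blinfun.rep_eq)

lemma scale_op_1 [simp]: "scale_op 1 = (id_blinfun :: 'a::complex_inner \<Rightarrow>\<^sub>L 'a)"
  by (intro blinfun_eqI) (simp add: scaleC_one)

lemma scale_op_minus: "scale_op (- a) = - (scale_op a :: 'a::complex_inner \<Rightarrow>\<^sub>L 'a)"
  using scale_op_add[of a "- a", where 'a = 'a] by (simp add: eq_neg_iff_add_eq_0 add.commute)

lemma norm_scale_op_le: "norm (scale_op c :: 'a::complex_inner \<Rightarrow>\<^sub>L 'a) \<le> cmod c"
  by (rule norm_blinfun_bound) (simp_all add: norm_scaleC)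

lemmas blinfun_compose_simps =
  bounded_bilinear.add_left[OF bounded_bilinear_blinfun_compose]
  bounded_bilinear.add_right[OF bounded_bilinear_blinfun_compose]
  bounded_bilinear.diff_left[OF bounded_bilinear_blinfun_compose]
  bounded_bilinear.diff_right[OF bounded_bilinear_blinfun_compose]
  bounded_bilinear.minus_left[OF bounded_bilinear_blinfun_compose]
  bounded_bilinear.minus_right[OF bounded_bilinear_blinfun_compose]

lemma blinfun_eq_iff: "A = B \<longleftrightarrow> (\<forall>x. blinfun_apply A x = blinfun_apply B x)"
  by (auto intro: blinfun_eqI)

lemma blinfun_compose_assoc: "(A o\<^sub>L B) o\<^sub>L C = A o\<^sub>L (B o\<^sub>L C)"
  by (intro blinfun_eqI) simp

text \<open>Complex homogeneity becomes an operator equation whose two sides are linear and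
  continuous in \<open>T\<close>, so closure under sums and norm limits follows from the bilinearity
  of composition.\<close>

lemma bounded_ops_iff_commute: "T \<in> bounded_ops \<longleftrightarrow> (\<forall>c. T o\<^sub>L scale_op c = scale_op c o\<^sub>L T)"
  by (auto simp: bounded_ops_def blinfun_eq_iff)

lemma bounded_ops_zero: "0 \<in> bounded_ops"
  by (simp add: bounded_ops_iff_commute)

lemma bounded_ops_add: "S \<in> bounded_ops \<Longrightarrow> T \<in> bounded_ops \<Longrightarrow> S + T \<in> bounded_ops"
  by (simp add: bounded_ops_iff_commute blinfun_compose_simps)

lemma bounded_ops_diff: "S \<in> bounded_ops \<Longrightarrow> T \<in> bounded_ops \<Longrightarrow> S - T \<in> bounded_ops"
  by (simp add: bounded_ops_iff_commute blinfun_compose_simps)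

lemma bounded_ops_compose: "S \<in> bounded_ops \<Longrightarrow> T \<in> bounded_ops \<Longrightarrow> S o\<^sub>L T \<in> bounded_ops"
  by (simp add: bounded_ops_def)

lemma bounded_ops_scale_op: "scale_op c \<in> bounded_ops"
  by (simp add: bounded_ops_def scaleC_scaleC mult.commute)

section \<open>Invertibility and compactness of the spectrum\<close>

definition invertible_op :: "('a::chilbert_space \<Rightarrow>\<^sub>L 'a) \<Rightarrow> bool" where
  "invertible_op A \<longleftrightarrow> (\<exists>S\<in>bounded_ops. S o\<^sub>L A = id_blinfun \<and> A o\<^sub>L S = id_blinfun)"

lemma not_in_op_spectrum_iff: "z \<notin> op_spectrum A \<longleftrightarrow> invertible_op (A - scale_op z)"
  by (simp add: op_spectrum_def invertible_op_def blinfun_eq_iff blinfun.diff_left)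

text \<open>The inverse of a complex-linear bijection is complex-linear, since
  \<open>c *\<^sub>C x\<close> is the image under \<open>A\<close> of
  \<open>c *\<^sub>C S x\<close>. This spares a separate check for the sum of a Neumann
  series.\<close>

lemma invertible_opI:
  assumes "A \<in> bounded_ops" "S o\<^sub>L A = id_blinfun" "A o\<^sub>L S = id_blinfun"
  shows "invertible_op A"
proof -
  have "S (c *\<^sub>C x) = c *\<^sub>C S x" for c x
  proof -
    have "S (c *\<^sub>C x) = S (c *\<^sub>C A (S x))"
      using assms(3) by (simp add: blinfun_eq_iff)
    also have "\<dots> = S (A (c *\<^sub>C S x))"
      using assms(1) by (simp add: bounded_ops_def)
    also have "\<dots> = c *\<^sub>C S x"
      using assms(2) by (simp add: blinfun_eq_iff)
    finally show ?thesis .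
  qed
  then show ?thesis
    using assms by (auto simp: invertible_op_def bounded_ops_def)
qed

lemma invertible_op_compose:
  assumes "invertible_op A" "invertible_op B"
  shows "invertible_op (A o\<^sub>L B)"
proof -
  obtain S T where "S \<in> bounded_ops" "S o\<^sub>L A = id_blinfun" "A o\<^sub>L S = id_blinfun"
    "T \<in> bounded_ops" "T o\<^sub>L B = id_blinfun" "B o\<^sub>L T = id_blinfun"
    using assms unfolding invertible_op_def by blast
  then show ?thesis
    unfolding invertible_op_def
    by (intro bexI[of _ "T o\<^sub>L S"]) (auto simp: blinfun_eq_iff bounded_ops_compose)
qed

lemma invertible_scale_op: "c \<noteq> 0 \<Longrightarrow> invertible_op (scale_op c)"
  unfolding invertible_op_def
  by (intro bexI[of _ "scale_op (1 / c)"]) (simp_all add: scale_op_mult[symmetric] bounded_ops_scale_op)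

text \<open>Neumann series: the powers \<open>P n\<close> of \<open>R\<close> are dominated by a
  geometric series, and splitting off the first term gives \<open>T = 1 + R T = 1 + T R\<close> for
  their sum \<open>T\<close>.\<close>

lemma invertible_id_minus:
  assumes R: "R \<in> bounded_ops" and "norm R < 1"
  shows "invertible_op (id_blinfun - R)"
proof -
  define P where "P n = (((\<lambda>S. R o\<^sub>L S) ^^ n) id_blinfun)" for n
  have P_Suc: "P (Suc n) = R o\<^sub>L P n" and P_Suc': "P (Suc n) = P n o\<^sub>L R" for n
    by (simp add: P_def, induction n) (simp_all add: P_def blinfun_eq_iff)
  have "norm (P n) \<le> norm R ^ n" for n
  proof (induction n)
    case (Suc n)
    have "norm (P (Suc n)) \<le> norm R * norm (P n)"
      unfolding P_Suc by (rule norm_blinfun_compose)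
    also have "\<dots> \<le> norm R * norm R ^ n"
      using Suc by (simp add: mult_left_mono)
    finally show ?case by simp
  qed (simp add: P_def norm_blinfun_id_le)
  then have P: "summable P"
    by (intro summable_norm_cancel[OF summable_comparison_test'[OF summable_geometric[of "norm R"], of 0]])
      (use assms in auto)
  have "suminf P = P 0 + (\<Sum>n. P (Suc n))"
    using suminf_split_head[OF P] by simp
  moreover have "(\<Sum>n. P (Suc n)) = R o\<^sub>L suminf P"
    unfolding P_Suc by (intro bounded_linear.suminf[OF _ P, symmetric] bounded_linear_intros)
  moreover have "(\<Sum>n. P (Suc n)) = suminf P o\<^sub>L R"
    unfolding P_Suc' by (intro bounded_linear.suminf[OF _ P, symmetric] bounded_linear_intros)
  moreover have "P 0 = id_blinfun" by (simp add: P_def)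
  ultimately have "suminf P = id_blinfun + (R o\<^sub>L suminf P)" "suminf P = id_blinfun + (suminf P o\<^sub>L R)"
    by auto
  moreover have "id_blinfun o\<^sub>L suminf P = suminf P" "suminf P o\<^sub>L id_blinfun = suminf P"
    by (simp_all add: blinfun_eq_iff)
  ultimately show ?thesis
    by (intro invertible_opI[of _ "suminf P"])
      (auto simp: blinfun_compose_simps diff_eq_eq intro!: bounded_ops_diff R
        bounded_ops_scale_op[of 1, simplified])
qed

text \<open>Both halves reduce to the Neumann series, through \<open>A - z = - z (1 - A / z)\<close>
  for large \<open>z\<close> and \<open>A - w = (A - z) (1 - (w - z) S)\<close> for \<open>w\<close>
  near a point \<open>z\<close> where \<open>S\<close> inverts \<open>A - z\<close>.\<close>

lemma compact_op_spectrum: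
  assumes A: "A \<in> bounded_ops"
  shows "compact (op_spectrum A)"
proof -
  have "cmod z \<le> norm A" if z: "z \<in> op_spectrum A" for z
  proof (rule ccontr)
    assume less: "\<not> cmod z \<le> norm A"
    then have "z \<noteq> 0" by auto
    have "norm (scale_op (1 / z) o\<^sub>L A) \<le> cmod (1 / z) * norm A"
      by (meson norm_blinfun_compose norm_scale_op_le mult_right_mono norm_ge_zero order_trans)
    also have "\<dots> < 1"
      using less by (simp add: norm_divide divide_less_eq)
    finally have "invertible_op (scale_op (- z) o\<^sub>L (id_blinfun - (scale_op (1 / z) o\<^sub>L A)))"
      using \<open>z \<noteq> 0\<close> A
      by (intro invertible_op_compose invertible_scale_op invertible_id_minus
          bounded_ops_compose bounded_ops_scale_op) auto
    also have "scale_op (- z) o\<^sub>L (id_blinfun - (scale_op (1 / z) o\<^sub>L A)) = A - scale_op z"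
      using \<open>z \<noteq> 0\<close>
      by (simp add: blinfun_compose_simps blinfun_compose_assoc[symmetric] scale_op_mult[symmetric])
       (simp add: blinfun_eq_iff blinfun.add_left blinfun.diff_left scale_op_minus blinfun.minus_left)
    finally show False
      using z by (simp add: not_in_op_spectrum_iff[symmetric])
  qed
  then have "bounded (op_spectrum A)"
    unfolding bounded_iff by blast
  moreover have "open (- op_spectrum A)"
    unfolding open_dist
  proof
    fix z assume "z \<in> - op_spectrum A"
    then obtain S where S: "S \<in> bounded_ops" "S o\<^sub>L (A - scale_op z) = id_blinfun"
      "(A - scale_op z) o\<^sub>L S = id_blinfun" and inv: "invertible_op (A - scale_op z)"
      using not_in_op_spectrum_iff[of z A] by (auto simp: invertible_op_def)
    \<comment> \<open>The summand 1 keeps the radius meaningful when \<open>S = 0\<close>, as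
      happens in the zero space.\<close>
    have "w \<in> - op_spectrum A" if w: "dist w z < 1 / (norm S + 1)" for w
    proof -
      have "norm (scale_op (w - z) o\<^sub>L S) \<le> cmod (w - z) * norm S"
        by (meson norm_blinfun_compose norm_scale_op_le mult_right_mono norm_ge_zero order_trans)
      also have "\<dots> \<le> 1 / (norm S + 1) * norm S"
        using w by (intro mult_right_mono) (auto simp: dist_norm)
      also have "\<dots> < 1"
        by (simp add: divide_less_eq add_nonneg_pos)
      finally have "invertible_op ((A - scale_op z) o\<^sub>L (id_blinfun - (scale_op (w - z) o\<^sub>L S)))"
        by (intro invertible_op_compose inv invertible_id_minus
          bounded_ops_compose bounded_ops_scale_op S)
      also have "(A - scale_op z) o\<^sub>L (id_blinfun - (scale_op (w - z) o\<^sub>L S)) = A - scale_op w"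
      proof -
        have "(A - scale_op z) o\<^sub>L (id_blinfun - (scale_op (w - z) o\<^sub>L S))
            = (A - scale_op z) - ((A - scale_op z) o\<^sub>L scale_op (w - z) o\<^sub>L S)"
          by (simp add: blinfun_eq_iff blinfun.diff_left blinfun.diff_right)
        also have "(A - scale_op z) o\<^sub>L scale_op (w - z) o\<^sub>L S
            = scale_op (w - z) o\<^sub>L ((A - scale_op z) o\<^sub>L S)"
          using bounded_ops_diff[OF A bounded_ops_scale_op[of z]]
          by (simp only: bounded_ops_iff_commute blinfun_compose_assoc)
        also have "(A - scale_op z) - \<dots> = A - (scale_op (w - z) + scale_op z)"
          unfolding S(3) by (simp add: blinfun_eq_iff blinfun.add_left blinfun.diff_left)
        finally show ?thesis
          by (simp add: scale_op_add[symmetric])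
      qed
      finally show ?thesis by (simp add: not_in_op_spectrum_iff)
    qed
    then show "\<exists>e>0. \<forall>w. dist w z < e \<longrightarrow> w \<in> - op_spectrum A"
      by (intro exI[of _ "1 / (norm S + 1)"]) (auto simp: add_nonneg_pos)
  qed
  ultimately show ?thesis
    by (simp add: compact_eq_bounded_closed closed_def)
qed

subsection \<open>Polynomials in a self-adjoint operator\<close>

lemma adjoint_pairD: "adjoint_pair S T \<Longrightarrow> cinner (blinfun_apply S x) y = cinner x (blinfun_apply T y)"
  by (simp add: adjoint_pair_def)

lemma adjoint_pair_add:
  "adjoint_pair S T \<Longrightarrow> adjoint_pair S' T' \<Longrightarrow> adjoint_pair (S + S') (T + T')"
  by (simp add: adjoint_pair_def blinfun.add_left cinner_add_left cinner_add_right)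

lemma adjoint_pair_compose:
  "adjoint_pair S T \<Longrightarrow> adjoint_pair S' T' \<Longrightarrow> adjoint_pair (S o\<^sub>L S') (T' o\<^sub>L T)"
  by (simp add: adjoint_pair_def)

lemma adjoint_pair_scale_op: "adjoint_pair (scale_op c) (scale_op (cnj c))"
  by (simp add: adjoint_pair_def cinner_scaleC_left cinner_scaleC_right)

text \<open>Nonnegativity of the quadratic form at \<open>w - t B w\<close> with \<open>t = 1 / norm B\<close>.\<close>

lemma norm_sq_le_of_positive:
  assumes B: "self_adjoint B" and pos: "\<And>w. 0 \<le> Re (cinner (blinfun_apply B w) w)"
  shows "(norm (blinfun_apply B w))\<^sup>2 \<le> norm B * Re (cinner (blinfun_apply B w) w)"
proof (cases "B = 0")
  case False
  define t where "t = 1 / norm B"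
  have t: "t > 0" "t * norm B = 1" using False by (auto simp: t_def)
  define q r n where "q = Re (cinner (B w) w)" and "r = Re (cinner (B (B w)) (B w))"
    and "n = (norm (B w))\<^sup>2"
  have BB: "Re (cinner (B w) (B w)) = n" "Re (cinner (B (B w)) w) = n"
    using B by (simp_all add: self_adjoint_def adjoint_pair_def cinner_self n_def)
  have "0 \<le> Re (cinner (B (w - t *\<^sub>R B w)) (w - t *\<^sub>R B w))" by (rule pos)
  also have "\<dots> = q - 2 * t * n + t\<^sup>2 * r"
    by (simp add: blinfun.diff_right blinfun.scaleR_right cinner_diff_left cinner_diff_right
        cinner_scaleR_left cinner_scaleR_right BB q_def[symmetric] r_def[symmetric]
        power2_eq_square algebra_simps)
  also have "r \<le> norm (B (B w)) * norm (B w)"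
    unfolding r_def by (rule Re_cinner_le)
  also have "norm (B (B w)) * norm (B w) \<le> norm B * n"
    unfolding n_def power2_eq_square mult.assoc[symmetric]
    by (intro mult_right_mono norm_blinfun norm_ge_zero)
  also have "q - 2 * t * n + t\<^sup>2 * (norm B * n) = q - 2 * t * n + t * (t * norm B) * n"
    by (simp add: power2_eq_square)
  finally have "t * n \<le> q"
    using t by (simp add: mult_left_mono mult.commute)
  then have "norm B * (t * n) \<le> norm B * q"
    by (simp add: mult_left_mono)
  then show ?thesis
    using t(2) by (simp add: q_def n_def mult.assoc[symmetric] mult.commute[of "norm B"])
qed simp

lemma Re_cinner_ge_minus_norm:
  fixes B :: "'a::chilbert_space \<Rightarrow>\<^sub>L 'a"
  assumes "norm w = 1"
  shows "- norm B \<le> Re (cinner (blinfun_apply B w) w)"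
  using abs_Re_cinner_le[of "B w" w] norm_blinfun[of B w] assms by simp

text \<open>The witness is the infimum of the numerical range.\<close>

lemma not_invertible_minus_le_quadratic_form:
  fixes B :: "'a::chilbert_space \<Rightarrow>\<^sub>L 'a"
  assumes B: "self_adjoint B" and y: "norm y = 1"
  obtains m where "m \<le> Re (cinner (blinfun_apply B y) y)"
    and "\<not> invertible_op (B - scale_op (complex_of_real m))"
proof
  define W where "W = (\<lambda>w. Re (cinner (B w) w)) ` {w. norm w = 1}"
  define m where "m = Inf W"
  define C where "C = B - scale_op (complex_of_real m)"
  have bdd: "bdd_below W"
    unfolding W_def by (auto intro!: bdd_belowI2[where m = "- norm B"] Re_cinner_ge_minus_norm)
  have m: "m \<le> Re (cinner (B w) w)" if "norm w = 1" for w
    unfolding m_def using bdd that by (auto intro!: cInf_lower simp: W_def)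
  then show "m \<le> Re (cinner (B y) y)" using y .
  have Cw: "Re (cinner (C w) w) = Re (cinner (B w) w) - m * (norm w)\<^sup>2" for w
    by (simp add: C_def blinfun.diff_left cinner_diff_left cinner_scaleC_left cinner_self)
  have C: "self_adjoint C"
    using B by (simp add: C_def self_adjoint_def adjoint_pair_def blinfun.diff_left
        cinner_diff_left cinner_diff_right cinner_scaleC_left cinner_scaleC_right)
  have pos: "0 \<le> Re (cinner (C w) w)" for w
  proof (cases "w = 0")
    case False
    define u where "u = (1 / norm w) *\<^sub>R w"
    have w: "w = norm w *\<^sub>R u" and u: "norm u = 1" using False by (auto simp: u_def)
    have "Re (cinner (C w) w) = (norm w)\<^sup>2 * Re (cinner (C u) u)"
      by (subst (1 2) w) (simp add: blinfun.scaleR_right cinner_scaleR_left cinner_scaleR_right power2_eq_square)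
    then show ?thesis using m[OF u] u by (simp add: Cw)
  qed simp
  show "\<not> invertible_op C"
  proof
    assume "invertible_op C"
    then obtain S where S: "S o\<^sub>L C = id_blinfun" by (auto simp: invertible_op_def)
    \<comment> \<open>Boundedness of \<open>S\<close> gives
      \<open>1 \<le> k * Re (cinner (C w) w)\<close> for every unit vector \<open>w\<close>. Hence
      \<open>m + 1 / k\<close> would still be a lower bound of \<open>W\<close>, against the choice
      of \<open>m\<close> as the infimum.\<close>
    define k where "k = (norm S)\<^sup>2 * norm C"
    have k: "1 \<le> k * (Re (cinner (B w) w) - m)" if "norm w = 1" for w
    proof -
      have "1 = norm (S (C w))" using S that by (simp add: blinfun_eq_iff)
      also have "\<dots> \<le> norm S * norm (C w)" by (rule norm_blinfun)
      finally have "1 \<le> (norm S * norm (C w))\<^sup>2"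
        by (simp add: one_le_power)
      also have "\<dots> = (norm S)\<^sup>2 * (norm (C w))\<^sup>2"
        by (simp add: power_mult_distrib)
      also have "\<dots> \<le> (norm S)\<^sup>2 * (norm C * Re (cinner (C w) w))"
        by (intro mult_left_mono norm_sq_le_of_positive C pos) simp
      finally show ?thesis using that by (simp add: k_def Cw mult.assoc)
    qed
    have "k \<noteq> 0" using k[OF y] by auto
    moreover have "k \<ge> 0" by (simp add: k_def)
    ultimately have "k > 0" by simp
    have "m + 1 / k \<le> Inf W"
    proof (rule cInf_greatest)
      show "W \<noteq> {}" using y by (auto simp: W_def)
      show "m + 1 / k \<le> v" if "v \<in> W" for v
        using that k \<open>k > 0\<close> by (auto simp: W_def field_simps)
    qed
    then show False using \<open>k > 0\<close> by (simp add: m_def)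
  qed
qed

section \<open>Polynomial functions of an operator\<close>

definition op_poly :: "('a::chilbert_space \<Rightarrow>\<^sub>L 'a) \<Rightarrow> complex poly \<Rightarrow> 'a \<Rightarrow>\<^sub>L 'a" where
  "op_poly A p = fold_coeffs (\<lambda>c T. scale_op c + (A o\<^sub>L T)) p 0"

lemma op_poly_0 [simp]: "op_poly A 0 = 0"
  by (simp add: op_poly_def)

lemma op_poly_pCons: "op_poly A (pCons c p) = scale_op c + (A o\<^sub>L op_poly A p)"
  by (cases "p = 0 \<and> c = 0") (auto simp: op_poly_def)

lemma op_poly_const: "op_poly A [:c:] = scale_op c"
  by (simp add: op_poly_pCons)

lemma op_poly_X: "op_poly A [:0, 1:] = A"
  by (simp add: op_poly_pCons blinfun_eq_iff)

lemma op_poly_add: "op_poly A (p + q) = op_poly A p + op_poly A q"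
  by (induction p q rule: poly_induct2)
    (simp_all add: op_poly_pCons scale_op_add blinfun_compose_simps)

lemma op_poly_minus: "op_poly A (- p) = - op_poly A p"
  using op_poly_add[of A p "- p"] by (simp add: eq_neg_iff_add_eq_0 add.commute)

lemma op_poly_diff: "op_poly A (p - q) = op_poly A p - op_poly A q"
  using op_poly_add[of A p "- q"] by (simp add: op_poly_minus)

lemma op_poly_in_bounded_ops: "A \<in> bounded_ops \<Longrightarrow> op_poly A p \<in> bounded_ops"
  by (induction p)
    (simp_all add: op_poly_pCons bounded_ops_zero bounded_ops_add bounded_ops_compose bounded_ops_scale_op)

lemma op_poly_smult: "A \<in> bounded_ops \<Longrightarrow> op_poly A (smult c p) = scale_op c o\<^sub>L op_poly A p"
proof (induction p)
  case (pCons a p)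
  have "A o\<^sub>L (scale_op c o\<^sub>L op_poly A p) = scale_op c o\<^sub>L (A o\<^sub>L op_poly A p)"
    using pCons(3) by (simp add: bounded_ops_iff_commute blinfun_compose_assoc[symmetric])
  then show ?case
    using pCons by (simp add: op_poly_pCons scale_op_mult blinfun_compose_simps)
qed simp

lemma op_poly_mult: "A \<in> bounded_ops \<Longrightarrow> op_poly A (p * q) = op_poly A p o\<^sub>L op_poly A q"
  by (induction p)
    (simp_all add: op_poly_pCons op_poly_add op_poly_smult blinfun_compose_simps blinfun_compose_assoc)

lemma op_poly_commute: "A \<in> bounded_ops \<Longrightarrow> A o\<^sub>L op_poly A p = op_poly A p o\<^sub>L A"
  using op_poly_mult[of A "[:0, 1:]" p] op_poly_mult[of A p "[:0, 1:]"]
  by (simp add: op_poly_X mult.commute)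

text \<open>Adjoints reverse the order of composition; \<open>A\<close> commutes with its own
  polynomials, which restores the order of the Horner scheme.\<close>

lemma adjoint_pair_op_poly:
  assumes "A \<in> bounded_ops" "self_adjoint A"
  shows "adjoint_pair (op_poly A p) (op_poly A (map_poly cnj p))"
proof (induction p)
  case (pCons c p)
  have "map_poly cnj (pCons c p) = pCons (cnj c) (map_poly cnj p)"
    using pCons(1) by (simp add: map_poly_pCons)
  moreover have "adjoint_pair (A o\<^sub>L op_poly A p) (A o\<^sub>L op_poly A (map_poly cnj p))"
    using adjoint_pair_compose[OF _ pCons(2), of A A] assms
    by (simp add: op_poly_commute self_adjoint_def)
  ultimately show ?case
    by (simp add: op_poly_pCons adjoint_pair_add adjoint_pair_scale_op)
qed (simp add: adjoint_pair_def)

text \<open>Read contrapositively for \<open>q - m\<close>, this is the inclusion of the spectrum of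
  \<open>q(A)\<close> in the image of the spectrum of \<open>A\<close> under \<open>q\<close>, one
  half of spectral mapping. The induction splits off one linear factor at a time and ends in a
  nonzero constant.\<close>

lemma invertible_op_poly:
  assumes A: "A \<in> bounded_ops" and "p \<noteq> 0" and "\<And>z. poly p z = 0 \<Longrightarrow> z \<notin> op_spectrum A"
  shows "invertible_op (op_poly A p)"
  using assms(2,3)
proof (induction "degree p" arbitrary: p)
  case 0
  then obtain c where "p = [:c:]" "c \<noteq> 0" by (metis degree_eq_zeroE pCons_0_0)
  then show ?case by (simp add: op_poly_const invertible_scale_op)
next
  case (Suc n)
  then have "\<not> constant (poly p)" by (simp add: constant_degree)
  then obtain z where z: "poly p z = 0" using fundamental_theorem_of_algebra by blast
  then obtain r where r: "p = [:- z, 1:] * r" by (auto simp: poly_eq_0_iff_dvd)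
  with Suc(3) have "r \<noteq> 0" by auto
  then have "degree p = Suc (degree r)" unfolding r by (subst degree_mult_eq) auto
  then have "invertible_op (op_poly A r)"
    using Suc \<open>r \<noteq> 0\<close> by (intro Suc(1)) (auto simp: r)
  moreover have "op_poly A [:- z, 1:] = A - scale_op z"
    by (simp add: op_poly_pCons scale_op_minus) (simp add: blinfun_eq_iff blinfun.diff_left blinfun.add_left blinfun.minus_left)
  then have "invertible_op (op_poly A [:- z, 1:])"
    using Suc(4)[OF z] by (simp add: not_in_op_spectrum_iff)
  ultimately show ?case
    unfolding r using A by (simp only: op_poly_mult invertible_op_compose)
qed

text \<open>The infimum of the numerical range is a spectral point. The unit vector excludes the
  zero space, where every operator is invertible and the spectrum is empty.\<close>

lemma op_spectrum_nonempty:
  fixes A :: "'a::chilbert_space \<Rightarrow>\<^sub>L 'a"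
  assumes "self_adjoint A" and "norm (y :: 'a) = 1"
  shows "op_spectrum A \<noteq> {}"
  using not_invertible_minus_le_quadratic_form[OF assms] not_in_op_spectrum_iff by (metis empty_iff)

lemma poly_le_op_poly_quadratic_form:
  fixes A :: "'a::chilbert_space \<Rightarrow>\<^sub>L 'a"
  assumes A: "A \<in> bounded_ops" "self_adjoint A" and q: "self_adjoint (op_poly A q)"
    and y: "norm y = 1"
  obtains z m where "z \<in> op_spectrum A" "poly q z = complex_of_real m"
    "m \<le> Re (cinner (blinfun_apply (op_poly A q) y) y)"
proof -
  obtain m where m: "m \<le> Re (cinner (op_poly A q y) y)"
    and "\<not> invertible_op (op_poly A q - scale_op (complex_of_real m))"
    using not_invertible_minus_le_quadratic_form[OF q y] .
  then have "\<not> invertible_op (op_poly A (q - [:complex_of_real m:]))"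
    by (simp add: op_poly_diff op_poly_const)
  then have "q - [:complex_of_real m:] = 0 \<or>
      (\<exists>z\<in>op_spectrum A. poly (q - [:complex_of_real m:]) z = 0)"
    using invertible_op_poly[OF A(1)] by blast
  \<comment> \<open>If \<open>q\<close> is the constant \<open>m\<close>, any spectral point will
    do, hence the appeal to nonemptiness.\<close>
  then have "\<exists>z\<in>op_spectrum A. poly q z = complex_of_real m"
    using op_spectrum_nonempty[OF A(2) y] by auto
  then show ?thesis using m that by blast
qed

text \<open>The previous lemma is applied to \<open>- cnj p * p\<close>, which is \<open>- (cmod p)\<^sup>2\<close> on the real spectrum.\<close>

lemma norm_op_poly_le:
  assumes A: "A \<in> bounded_ops" "self_adjoint A" and real: "op_spectrum A \<subseteq> \<real>"
    and C: "C \<ge> 0" "\<And>z. z \<in> op_spectrum A \<Longrightarrow> cmod (poly p z) \<le> C"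
  shows "norm (op_poly A p) \<le> C"
proof (rule norm_blinfun_bound[OF C(1)])
  have unit: "norm (op_poly A p u) \<le> C" if u: "norm u = 1" for u
  proof -
    let ?p' = "map_poly cnj p"
    let ?q = "- (?p' * p)"
    have adj: "adjoint_pair (op_poly A p) (op_poly A ?p')"
      using A by (rule adjoint_pair_op_poly)
    have q: "op_poly A ?q = - (op_poly A ?p' o\<^sub>L op_poly A p)"
      using A by (simp only: op_poly_minus op_poly_mult)
    have adj': "cinner (op_poly A ?p' x) y = cinner x (op_poly A p y)" for x y
      by (metis adjoint_pairD[OF adj] cinner_commute)
    have "self_adjoint (op_poly A ?q)"
      unfolding q self_adjoint_def adjoint_pair_def
      by (simp add: blinfun.minus_left cinner_minus_left cinner_minus_right adj' adjoint_pairD[OF adj])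
    then obtain z m where z: "z \<in> op_spectrum A" and m: "poly ?q z = complex_of_real m"
      and le: "m \<le> Re (cinner (op_poly A ?q u) u)"
      using poly_le_op_poly_quadratic_form[OF A _ u] by blast
    have "cnj z = z" using z real by (auto simp: Reals_cnj_iff)
    then have "poly ?p' z = cnj (poly p z)"
      by (metis poly_cnj)
    then have "poly ?q z = - (poly p z * cnj (poly p z))"
      by simp
    also have "\<dots> = complex_of_real (- ((cmod (poly p z))\<^sup>2))"
      by (simp only: complex_norm_square of_real_minus)
    finally have "m = - ((cmod (poly p z))\<^sup>2)"
      unfolding m by (simp only: of_real_eq_iff)
    moreover have "Re (cinner (op_poly A ?q u) u) = - ((norm (op_poly A p u))\<^sup>2)"
      unfolding q by (simp add: blinfun.minus_left cinner_minus_left adj' cinner_self)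
    \<comment> \<open>The minus sign in \<open>?q\<close> turns the lower bound on its quadratic
      form into an upper bound on the norm.\<close>
    ultimately have "(norm (op_poly A p u))\<^sup>2 \<le> (cmod (poly p z))\<^sup>2"
      using le by simp
    then show ?thesis
      using C(2)[OF z] by (meson norm_ge_zero order_trans power2_le_imp_le)
  qed
  show "norm (op_poly A p y) \<le> C * norm y" for y
  proof (cases "y = 0")
    case False
    then have "norm (op_poly A p ((1 / norm y) *\<^sub>R y)) \<le> C"
      by (intro unit) simp
    then show ?thesis using False by (simp add: blinfun.scaleR_right field_simps)
  qed simp
qed

subsection \<open>The continuous functional calculus\<close>

lemma poly_add_fun: "poly (p + q) = (\<lambda>z. poly p z + poly q z)"
  by (simp add: fun_eq_iff)

lemma poly_mult_fun: "poly (p * q) = (\<lambda>z. poly p z * poly q z)"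
  by (simp add: fun_eq_iff)

text \<open>The imaginary part is the real part after replacing \<open>x\<close> by
  \<open>(- \<i>) *\<^sub>C x\<close>, so the bound on real parts applies twice. The resulting
  constant 2 is crude, but the purpose is continuity.\<close>

lemma bounded_bilinear_cinner: "bounded_bilinear (cinner :: 'a::complex_inner \<Rightarrow> _)"
proof
  have "norm (cinner x y) \<le> norm x * norm y * 2" for x y :: 'a
  proof -
    have "Im (cinner x y) = Re (cinner ((- \<i>) *\<^sub>C x) y)"
      by (simp only: cinner_scaleC_left) simp
    then have "\<bar>Im (cinner x y)\<bar> \<le> norm x * norm y"
      using abs_Re_cinner_le[of "(- \<i>) *\<^sub>C x" y] by (simp add: norm_scaleC)
    then show ?thesis
      using cmod_le[of "cinner x y"] abs_Re_cinner_le[of x y] by linarith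
  qed
  then show "\<exists>K. \<forall>x y :: 'a. norm (cinner x y) \<le> norm x * norm y * K" by blast
qed (simp_all add: cinner_add_left cinner_add_right cinner_scaleR_left cinner_scaleR_right scaleR_conv_of_real)

lemma adjoint_pair_LIMSEQ:
  assumes "\<And>n. adjoint_pair (S n) (T n)" "S \<longlonglongrightarrow> S'" "T \<longlonglongrightarrow> T'"
  shows "adjoint_pair S' T'"
  unfolding adjoint_pair_def
proof (intro allI)
  fix x y
  have "(\<lambda>n. cinner (S n x) y) \<longlonglongrightarrow> cinner (S' x) y"
    by (intro bounded_bilinear.tendsto[OF bounded_bilinear_cinner] blinfun.tendsto assms tendsto_const)
  moreover have "(\<lambda>n. cinner x (T n y)) \<longlonglongrightarrow> cinner x (T' y)"
    by (intro bounded_bilinear.tendsto[OF bounded_bilinear_cinner] blinfun.tendsto assms tendsto_const)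
  ultimately show "cinner (S' x) y = cinner x (T' y)"
    using assms(1) by (simp add: adjoint_pair_def LIMSEQ_unique)
qed

lemma bounded_ops_LIMSEQ:
  assumes "\<And>n. S n \<in> bounded_ops" "S \<longlonglongrightarrow> S'"
  shows "S' \<in> bounded_ops"
  unfolding bounded_ops_iff_commute
proof
  fix c
  have "(\<lambda>n. S n o\<^sub>L scale_op c) \<longlonglongrightarrow> (S' o\<^sub>L scale_op c)"
    "(\<lambda>n. scale_op c o\<^sub>L S n) \<longlonglongrightarrow> (scale_op c o\<^sub>L S')"
    by (intro bounded_bilinear.tendsto[OF bounded_bilinear_blinfun_compose] assms tendsto_const)+
  then show "S' o\<^sub>L scale_op c = scale_op c o\<^sub>L S'"
    using assms(1) by (simp add: bounded_ops_iff_commute LIMSEQ_unique)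
qed

text \<open>On real points \<open>u\<close> is a function of one real variable, to which the
  Weierstrass theorem applies; its real coefficients are then read as complex ones. For compact sets
  off the real line, polynomials in \<open>z\<close> alone are not dense in general.\<close>

lemma real_function_approx_poly:
  assumes K: "compact K" "K \<subseteq> \<real>" and u: "continuous_on K (u :: complex \<Rightarrow> real)" and "e > 0"
  obtains p where "\<And>z. z \<in> K \<Longrightarrow> cmod (poly p z - complex_of_real (u z)) < e"
proof -
  have re: "complex_of_real (Re z) = z" if "z \<in> K" for z
    using that K(2) by (auto elim: Reals_cases)
  have "compact (Re ` K)"
    using K(1) by (intro compact_continuous_image continuous_intros)
  moreover have "continuous_on (Re ` K) (\<lambda>t. u (complex_of_real t))"
    by (rule continuous_on_compose2[OF u]) (auto intro!: continuous_intros simp: re)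
  ultimately obtain r where r: "real_polynomial_function r"
    "\<And>t. t \<in> Re ` K \<Longrightarrow> \<bar>u (complex_of_real t) - r t\<bar> < e"
    using Stone_Weierstrass_real_polynomial_function[OF _ _ \<open>e > 0\<close>] by metis
  then obtain a n where a: "r = (\<lambda>t. \<Sum>i\<le>n. a i * t ^ i)"
    using real_polynomial_function_iff_sum by blast
  define p where "p = (\<Sum>i\<le>n. monom (complex_of_real (a i)) i)"
  have "cmod (poly p z - complex_of_real (u z)) < e" if "z \<in> K" for z
  proof -
    have "poly p z = poly p (complex_of_real (Re z))" by (simp add: re that)
    also have "\<dots> = complex_of_real (r (Re z))"
      by (simp add: p_def a poly_sum poly_monom)
    finally have "cmod (poly p z - complex_of_real (u z)) = \<bar>r (Re z) - u z\<bar>"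
      by (metis norm_of_real of_real_diff real_norm_def)
    then show ?thesis using r(2)[of "Re z"] that by (simp add: re abs_minus_commute)
  qed
  then show ?thesis by (rule that)
qed

lemma complex_function_approx_poly:
  assumes K: "compact K" "K \<subseteq> \<real>" and u: "continuous_on K u" and "e > 0"
  obtains p where "\<And>z. z \<in> K \<Longrightarrow> cmod (poly p z - u z) < e"
proof -
  obtain p where p: "\<And>z. z \<in> K \<Longrightarrow> cmod (poly p z - complex_of_real (Re (u z))) < e / 2"
    using real_function_approx_poly[OF K, of "\<lambda>z. Re (u z)" "e / 2"] u \<open>e > 0\<close>
    by (auto intro: continuous_intros)
  obtain q where q: "\<And>z. z \<in> K \<Longrightarrow> cmod (poly q z - complex_of_real (Im (u z))) < e / 2"
    using real_function_approx_poly[OF K, of "\<lambda>z. Im (u z)" "e / 2"] u \<open>e > 0\<close>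
    by (auto intro: continuous_intros)
  have "cmod (poly (p + smult \<i> q) z - u z) < e" if "z \<in> K" for z
  proof -
    have "poly (p + smult \<i> q) z - u z = (poly p z - complex_of_real (Re (u z)))
        + \<i> * (poly q z - complex_of_real (Im (u z)))"
      by (simp add: complex_eq_iff)
    then have "cmod (poly (p + smult \<i> q) z - u z) \<le> cmod (poly p z - complex_of_real (Re (u z)))
        + cmod (\<i> * (poly q z - complex_of_real (Im (u z))))"
      by (simp only: norm_triangle_ineq)
    then show ?thesis using p[OF that] q[OF that] by (simp add: norm_mult)
  qed
  then show ?thesis by (rule that)
qed

text \<open>A relation witnessed by a single approximating sequence.
  \<open>calculus_limit_LIMSEQ\<close> extends it to all such sequences, so each law can be checked
  along whichever sequence suits it.\<close>

definition calculus_limit ::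
  "('a::chilbert_space \<Rightarrow>\<^sub>L 'a) \<Rightarrow> (complex \<Rightarrow> complex) \<Rightarrow> ('a \<Rightarrow>\<^sub>L 'a) \<Rightarrow> bool" where
  "calculus_limit A u T \<longleftrightarrow> (\<exists>p. uniform_limit (op_spectrum A) (\<lambda>n. poly (p n)) u sequentially
     \<and> (\<lambda>n. op_poly A (p n)) \<longlonglongrightarrow> T)"

context
  fixes A :: "'a::chilbert_space \<Rightarrow>\<^sub>L 'a"
  assumes A: "A \<in> bounded_ops" "self_adjoint A" and real: "op_spectrum A \<subseteq> \<real>"
begin

lemma calculus_limit_exists:
  assumes "continuous_on (op_spectrum A) u"
  obtains T where "calculus_limit A u T"
proof -
  have "\<exists>p. \<forall>z\<in>op_spectrum A. cmod (poly p z - u z) < inverse (real (Suc n))" for n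
    using complex_function_approx_poly[OF compact_op_spectrum[OF A(1)] real assms,
        of "inverse (real (Suc n))"] by (metis inverse_positive_iff_positive of_nat_0_less_iff zero_less_Suc)
  then obtain p where p: "\<And>n z. z \<in> op_spectrum A \<Longrightarrow> cmod (poly (p n) z - u z) < inverse (real (Suc n))"
    by metis
  have lim: "uniform_limit (op_spectrum A) (\<lambda>n. poly (p n)) u sequentially"
  proof (rule uniform_limitI)
    fix e :: real assume "e > 0"
    then have "\<forall>\<^sub>F n in sequentially. inverse (real (Suc n)) < e"
      by (rule order_tendstoD(2)[OF LIMSEQ_inverse_real_of_nat])
    then show "\<forall>\<^sub>F n in sequentially. \<forall>z\<in>op_spectrum A. dist (poly (p n) z) (u z) < e"
      by eventually_elim (use p in \<open>force simp: dist_norm intro: less_trans\<close>)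
  qed
  have "Cauchy (\<lambda>n. op_poly A (p n))"
  proof (rule CauchyI)
    fix e :: real assume e: "e > 0"
    obtain M where M: "\<And>m n z. m \<ge> M \<Longrightarrow> n \<ge> M \<Longrightarrow> z \<in> op_spectrum A \<Longrightarrow>
        dist (poly (p m) z) (poly (p n) z) < e / 2"
      using uniformly_convergent_Cauchy[OF uniformly_convergentI[OF lim]] e
      unfolding uniformly_Cauchy_on_def by (meson half_gt_zero)
    have "norm (op_poly A (p m) - op_poly A (p n)) < e" if "m \<ge> M" "n \<ge> M" for m n
    proof -
      \<comment> \<open>\<open>norm_op_poly_le\<close> gives a weak inequality; aiming at
        \<open>e / 2\<close> leaves room for the strict one.\<close>
      have "norm (op_poly A (p m - p n)) \<le> e / 2"
        using M[OF that] e by (intro norm_op_poly_le A real) (auto simp: dist_norm intro: less_imp_le)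
      then show ?thesis using e by (simp add: op_poly_diff)
    qed
    then show "\<exists>M. \<forall>m\<ge>M. \<forall>n\<ge>M. norm (op_poly A (p m) - op_poly A (p n)) < e"
      by blast
  qed
  then obtain T where "(\<lambda>n. op_poly A (p n)) \<longlonglongrightarrow> T"
    by (meson Cauchy_convergent_iff convergent_def)
  then show ?thesis using that lim unfolding calculus_limit_def by blast
qed

text \<open>Two sequences with the same uniform limit differ by polynomials tending uniformly to 0
  on the spectrum, and the norm bound carries this over to the operators.\<close>

lemma calculus_limit_LIMSEQ:
  assumes "calculus_limit A u T" and q: "uniform_limit (op_spectrum A) (\<lambda>n. poly (q n)) u sequentially"
  shows "(\<lambda>n. op_poly A (q n)) \<longlonglongrightarrow> T"
proof -
  obtain p where p: "uniform_limit (op_spectrum A) (\<lambda>n. poly (p n)) u sequentially"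
    and T: "(\<lambda>n. op_poly A (p n)) \<longlonglongrightarrow> T"
    using assms(1) by (auto simp: calculus_limit_def)
  have lim: "uniform_limit (op_spectrum A) (\<lambda>n z. poly (q n) z - poly (p n) z) (\<lambda>z. u z - u z) sequentially"
    by (intro uniform_limit_intros q p)
  have "(\<lambda>n. op_poly A (q n - p n)) \<longlonglongrightarrow> 0"
  proof (rule LIMSEQ_I)
    fix e :: real assume e: "e > 0"
    then obtain M where "\<And>n z. n \<ge> M \<Longrightarrow> z \<in> op_spectrum A \<Longrightarrow> cmod (poly (q n - p n) z) < e / 2"
      using uniform_limitD[OF lim, of "e / 2"] by (auto simp: eventually_sequentially)
    then have "norm (op_poly A (q n - p n)) \<le> e / 2" if "n \<ge> M" for n
      using that e by (intro norm_op_poly_le A real) (auto intro: less_imp_le)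
    then have "norm (op_poly A (q n - p n) - 0) < e" if "n \<ge> M" for n
      using that e by fastforce
    then show "\<exists>M. \<forall>n\<ge>M. norm (op_poly A (q n - p n) - 0) < e"
      by blast
  qed
  from tendsto_add[OF this T] show ?thesis
    by (simp add: op_poly_diff)
qed

lemma calculus_limit_unique:
  assumes "calculus_limit A u S" "calculus_limit A v T" "\<And>z. z \<in> op_spectrum A \<Longrightarrow> u z = v z"
  shows "S = T"
proof -
  obtain p where p: "uniform_limit (op_spectrum A) (\<lambda>n. poly (p n)) v sequentially"
    and T: "(\<lambda>n. op_poly A (p n)) \<longlonglongrightarrow> T"
    using assms(2) by (auto simp: calculus_limit_def)
  then have "uniform_limit (op_spectrum A) (\<lambda>n. poly (p n)) u sequentially"
    by (subst uniform_limit_cong'[where i = v]) (auto simp: assms(3))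
  then show ?thesis
    using calculus_limit_LIMSEQ[OF assms(1)] T LIMSEQ_unique by blast
qed

lemma calculus_limit_poly: "calculus_limit A (poly p) (op_poly A p)"
  unfolding calculus_limit_def
  by (intro exI[of _ "\<lambda>_. p"] conjI uniform_limit_const tendsto_const)

lemma calculus_limit_add:
  assumes "calculus_limit A u S" "calculus_limit A v T"
  shows "calculus_limit A (\<lambda>z. u z + v z) (S + T)"
proof -
  obtain p q where "uniform_limit (op_spectrum A) (\<lambda>n. poly (p n)) u sequentially"
    "(\<lambda>n. op_poly A (p n)) \<longlonglongrightarrow> S"
    "uniform_limit (op_spectrum A) (\<lambda>n. poly (q n)) v sequentially"
    "(\<lambda>n. op_poly A (q n)) \<longlonglongrightarrow> T"
    using assms by (auto simp: calculus_limit_def)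
  then show ?thesis
    unfolding calculus_limit_def
    by (intro exI[of _ "\<lambda>n. p n + q n"]) (auto simp: op_poly_add poly_add_fun intro!: uniform_limit_intros tendsto_intros)
qed

text \<open>Uniform convergence passes to products when the limits are bounded, which continuity on
  the compact spectrum ensures.\<close>

lemma calculus_limit_mult:
  assumes "calculus_limit A u S" "calculus_limit A v T"
    and "continuous_on (op_spectrum A) u" "continuous_on (op_spectrum A) v"
  shows "calculus_limit A (\<lambda>z. u z * v z) (S o\<^sub>L T)"
proof -
  obtain p q where "uniform_limit (op_spectrum A) (\<lambda>n. poly (p n)) u sequentially"
    "(\<lambda>n. op_poly A (p n)) \<longlonglongrightarrow> S"
    "uniform_limit (op_spectrum A) (\<lambda>n. poly (q n)) v sequentially"
    "(\<lambda>n. op_poly A (q n)) \<longlonglongrightarrow> T"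
    using assms by (auto simp: calculus_limit_def)
  moreover have "bounded (u ` op_spectrum A)" "bounded (v ` op_spectrum A)"
    using assms(3,4) compact_op_spectrum[OF A(1)]
    by (auto intro: compact_imp_bounded compact_continuous_image)
  ultimately show ?thesis
    unfolding calculus_limit_def
    by (intro exI[of _ "\<lambda>n. p n * q n"])
      (auto simp: op_poly_mult A poly_mult_fun intro!: uniform_lim_mult
        bounded_bilinear.tendsto[OF bounded_bilinear_blinfun_compose])
qed

lemma calculus_limit_in_bounded_ops: "calculus_limit A u T \<Longrightarrow> T \<in> bounded_ops"
  by (auto simp: calculus_limit_def intro: bounded_ops_LIMSEQ op_poly_in_bounded_ops[OF A(1)])

lemma calculus_limit_adjoint_pair:
  assumes "calculus_limit A u S" "calculus_limit A (\<lambda>z. cnj (u z)) T"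
  shows "adjoint_pair S T"
proof -
  obtain p where p: "uniform_limit (op_spectrum A) (\<lambda>n. poly (p n)) u sequentially"
    and S: "(\<lambda>n. op_poly A (p n)) \<longlonglongrightarrow> S"
    using assms by (auto simp: calculus_limit_def)
  have "poly (map_poly cnj (p n)) z = cnj (poly (p n) z)" if "z \<in> op_spectrum A" for n z
    using that real by (metis poly_cnj Reals_cnj_iff subsetD)
  then have "uniform_limit (op_spectrum A) (\<lambda>n. poly (map_poly cnj (p n))) (\<lambda>z. cnj (u z)) sequentially"
    using bounded_linear.uniform_limit[OF bounded_linear_cnj p]
    by (subst uniform_limit_cong') auto
  then have "(\<lambda>n. op_poly A (map_poly cnj (p n))) \<longlonglongrightarrow> T"
    by (rule calculus_limit_LIMSEQ[OF assms(2)])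
  then show ?thesis
    using adjoint_pair_LIMSEQ[OF adjoint_pair_op_poly[OF A] S] by blast
qed

lemma is_functional_calculus_functional_calculus:
  "is_functional_calculus A (functional_calculus A)"
proof -
  define \<Phi> where "\<Phi> u = (SOME T. calculus_limit A u T)" for u
  let ?C = "{u. continuous_on (op_spectrum A) u}"
  have \<Phi>: "calculus_limit A u (\<Phi> u)" if "u \<in> ?C" for u
    unfolding \<Phi>_def by (rule someI_ex) (use that calculus_limit_exists in auto)
  have \<Phi>_eq: "\<Phi> u = T" if "calculus_limit A u T" for u T
  proof -
    have "calculus_limit A u (\<Phi> u)" unfolding \<Phi>_def using that by (rule someI)
    then show ?thesis using that by (rule calculus_limit_unique) simp
  qed
  have \<Phi>_poly: "\<Phi> (poly p) = op_poly A p" for p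
    by (rule \<Phi>_eq[OF calculus_limit_poly])
  have const: "calculus_limit A (\<lambda>z. c) (scale_op c)" for c
  proof -
    have "poly [:c:] = (\<lambda>z. c)" by (simp add: fun_eq_iff)
    then show ?thesis using calculus_limit_poly[of "[:c:]"] by (simp add: op_poly_const)
  qed
  have "is_functional_calculus A \<Phi>"
    unfolding is_functional_calculus_def Let_def
  proof (intro conjI ballI allI impI)
    show "\<Phi> u \<in> bounded_ops" if "u \<in> ?C" for u
      by (rule calculus_limit_in_bounded_ops[OF \<Phi>[OF that]])
    show "\<Phi> u = \<Phi> v" if "u \<in> ?C" "v \<in> ?C" "\<forall>z\<in>op_spectrum A. u z = v z" for u v
      by (rule calculus_limit_unique[OF \<Phi>[OF that(1)] \<Phi>[OF that(2)]]) (use that(3) in blast)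
    show "\<Phi> (\<lambda>z. u z + v z) = \<Phi> u + \<Phi> v" if "u \<in> ?C" "v \<in> ?C" for u v
      by (rule \<Phi>_eq[OF calculus_limit_add[OF \<Phi>[OF that(1)] \<Phi>[OF that(2)]]])
    \<comment> \<open>An arbitrary limit \<open>S\<close> is allowed so that the scalar law is the
      case of the constant function \<open>c\<close> with \<open>S = scale_op c\<close>.\<close>
    have mult: "\<Phi> (\<lambda>z. u z * v z) = S o\<^sub>L \<Phi> v" if "u \<in> ?C" "v \<in> ?C" "calculus_limit A u S" for u v S
      by (rule \<Phi>_eq[OF calculus_limit_mult[OF that(3) \<Phi>[OF that(2)]]]) (use that in auto)
    show "\<Phi> (\<lambda>z. u z * v z) = \<Phi> u o\<^sub>L \<Phi> v" if "u \<in> ?C" "v \<in> ?C" for u v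
      by (rule mult[OF that \<Phi>[OF that(1)]])
    show "\<Phi> (\<lambda>z. c * u z) x = c *\<^sub>C \<Phi> u x" if "u \<in> ?C" for c u x
      using mult[OF _ that const, of c] by simp
    show "adjoint_pair (\<Phi> u) (\<Phi> (\<lambda>z. cnj (u z)))" if "u \<in> ?C" for u
      by (rule calculus_limit_adjoint_pair[OF \<Phi>[OF that] \<Phi>]) (use that in \<open>auto intro!: continuous_intros\<close>)
    show "\<Phi> (\<lambda>z. 1) = id_blinfun"
      using \<Phi>_eq[OF const, of 1] by simp
    show "\<Phi> (\<lambda>z. z) = A"
    proof -
      have "poly [:0, 1:] = (\<lambda>z::complex. z)" by (simp add: fun_eq_iff)
      then show ?thesis using \<Phi>_poly[of "[:0, 1:]"] by (simp add: op_poly_X)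
    qed
  qed
  then show ?thesis
    unfolding functional_calculus_def by (rule someI[where P = "is_functional_calculus A"])
qed

end

section \<open>Consequences of the calculus axioms, in particular positivity\<close>

lemma is_functional_calculusD:
  assumes "is_functional_calculus A \<Phi>" and "continuous_on (op_spectrum A) u"
  shows is_functional_calculus_scale: "\<Phi> (\<lambda>z. c * u z) = scale_op c o\<^sub>L \<Phi> u"
    and is_functional_calculus_adjoint: "adjoint_pair (\<Phi> u) (\<Phi> (\<lambda>z. cnj (u z)))"
    and is_functional_calculus_cong: "continuous_on (op_spectrum A) v \<Longrightarrow>
      (\<And>z. z \<in> op_spectrum A \<Longrightarrow> u z = v z) \<Longrightarrow> \<Phi> u = \<Phi> v"
    and is_functional_calculus_add: "continuous_on (op_spectrum A) v \<Longrightarrow>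
      \<Phi> (\<lambda>z. u z + v z) = \<Phi> u + \<Phi> v"
    and is_functional_calculus_mult: "continuous_on (op_spectrum A) v \<Longrightarrow>
      \<Phi> (\<lambda>z. u z * v z) = \<Phi> u o\<^sub>L \<Phi> v"
proof -
  let ?C = "{u. continuous_on (op_spectrum A) u}"
  have u: "u \<in> ?C" using assms(2) by simp
  have scale: "\<forall>c. \<forall>u\<in>?C. \<forall>x. \<Phi> (\<lambda>z. c * u z) x = c *\<^sub>C \<Phi> u x"
    and adjoint: "\<forall>u\<in>?C. adjoint_pair (\<Phi> u) (\<Phi> (\<lambda>z. cnj (u z)))"
    and cong: "\<forall>u\<in>?C. \<forall>v\<in>?C. (\<forall>z\<in>op_spectrum A. u z = v z) \<longrightarrow> \<Phi> u = \<Phi> v"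
    and add: "\<forall>u\<in>?C. \<forall>v\<in>?C. \<Phi> (\<lambda>z. u z + v z) = \<Phi> u + \<Phi> v"
    and mult: "\<forall>u\<in>?C. \<forall>v\<in>?C. \<Phi> (\<lambda>z. u z * v z) = \<Phi> u o\<^sub>L \<Phi> v"
    by (insert assms(1)[unfolded is_functional_calculus_def Let_def], (elim conjE, assumption)+)
  show "\<Phi> (\<lambda>z. c * u z) = scale_op c o\<^sub>L \<Phi> u"
    using scale[rule_format, OF u] by (intro blinfun_eqI) simp
  show "adjoint_pair (\<Phi> u) (\<Phi> (\<lambda>z. cnj (u z)))"
    using adjoint[rule_format, OF u] .
  show "\<Phi> u = \<Phi> v" if "continuous_on (op_spectrum A) v" "\<And>z. z \<in> op_spectrum A \<Longrightarrow> u z = v z"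
    by (rule cong[rule_format, OF u]) (simp_all add: that)
  show "\<Phi> (\<lambda>z. u z + v z) = \<Phi> u + \<Phi> v" if "continuous_on (op_spectrum A) v"
    by (rule add[rule_format, OF u]) (simp add: that)
  show "\<Phi> (\<lambda>z. u z * v z) = \<Phi> u o\<^sub>L \<Phi> v" if "continuous_on (op_spectrum A) v"
    by (rule mult[rule_format, OF u]) (simp add: that)
qed

lemma is_functional_calculus_one: "is_functional_calculus A \<Phi> \<Longrightarrow> \<Phi> (\<lambda>z. 1) = id_blinfun"
  and is_functional_calculus_ident: "is_functional_calculus A \<Phi> \<Longrightarrow> \<Phi> (\<lambda>z. z) = A"
  unfolding is_functional_calculus_def Let_def by ((elim conjE, assumption)+)

lemma functional_calculus_nonneg:
  assumes \<Phi>: "is_functional_calculus A \<Phi>"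
    and u: "continuous_on (op_spectrum A) u" "\<And>z. z \<in> op_spectrum A \<Longrightarrow> 0 \<le> u z"
  shows "0 \<le> Re (cinner (blinfun_apply (\<Phi> (\<lambda>z. complex_of_real (u z))) x) x)"
proof -
  define r where "r z = complex_of_real (sqrt (u z))" for z
  have r: "continuous_on (op_spectrum A) r"
    unfolding r_def using u(1) by (intro continuous_intros)
  \<comment> \<open>Off the spectrum \<open>u\<close> may be negative and differ from
    \<open>r * r\<close>, so the two functions are identified by the congruence axiom.\<close>
  have "\<Phi> (\<lambda>z. complex_of_real (u z)) = \<Phi> (\<lambda>z. r z * r z)"
    using u r by (intro is_functional_calculus_cong[OF \<Phi>] continuous_intros)
      (simp_all add: r_def flip: of_real_mult)
  also have "\<dots> = \<Phi> r o\<^sub>L \<Phi> r"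
    by (rule is_functional_calculus_mult[OF \<Phi> r r])
  finally have "cinner (\<Phi> (\<lambda>z. complex_of_real (u z)) x) x = cinner (\<Phi> r (\<Phi> r x)) x"
    by simp
  also have "\<dots> = cinner (\<Phi> r x) (\<Phi> (\<lambda>z. cnj (r z)) x)"
    by (rule adjoint_pairD[OF is_functional_calculus_adjoint[OF \<Phi> r]])
  also have "(\<lambda>z. cnj (r z)) = r" by (simp add: r_def fun_eq_iff)
  finally show ?thesis by (simp add: cinner_self)
qed

text \<open>Linearity, normalization and positivity of the functional in one statement; the unit
  vector makes the constant \<open>a\<close> contribute exactly \<open>a\<close>. Two functions
  suffice, as each use of a supporting line compares \<open>g \<circ> f\<close> with an affine
  expression in the identity or in \<open>f\<close>.\<close>

lemma fun_of_op_affine_nonneg: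
  fixes A :: "'a::chilbert_space \<Rightarrow>\<^sub>L 'a"
  assumes \<Phi>: "is_functional_calculus A (functional_calculus A)" and x: "norm x = 1"
    and \<phi>: "continuous_on (op_spectrum A) (\<lambda>z. \<phi> (Re z))"
    and \<psi>: "continuous_on (op_spectrum A) (\<lambda>z. \<psi> (Re z))"
    and nonneg: "\<And>z. z \<in> op_spectrum A \<Longrightarrow> 0 \<le> a + b * \<phi> (Re z) + c * \<psi> (Re z)"
  shows "0 \<le> a + b * Re (cinner (blinfun_apply (fun_of_op \<phi> A) x) x)
    + c * Re (cinner (blinfun_apply (fun_of_op \<psi> A) x) x)"
proof -
  let ?F = "functional_calculus A"
  let ?\<phi> = "\<lambda>z. complex_of_real (\<phi> (Re z))" and ?\<psi> = "\<lambda>z. complex_of_real (\<psi> (Re z))"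
  have C: "continuous_on (op_spectrum A) ?\<phi>" "continuous_on (op_spectrum A) ?\<psi>"
    using \<phi> \<psi> by (auto intro: continuous_on_of_real)
  have const: "?F (\<lambda>z. complex_of_real a) = scale_op (complex_of_real a)"
    using is_functional_calculus_scale[OF \<Phi> continuous_on_const[of _ 1], of "complex_of_real a"]
    by (simp add: is_functional_calculus_one[OF \<Phi>] blinfun_eq_iff)
  have "0 \<le> Re (cinner (?F (\<lambda>z. complex_of_real (a + b * \<phi> (Re z) + c * \<psi> (Re z))) x) x)"
    by (rule functional_calculus_nonneg[OF \<Phi>]) (intro continuous_intros \<phi> \<psi> nonneg)+
  also have "(\<lambda>z. complex_of_real (a + b * \<phi> (Re z) + c * \<psi> (Re z)))
      = (\<lambda>z. complex_of_real a + complex_of_real b * ?\<phi> z + complex_of_real c * ?\<psi> z)"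
    by simp
  also have "?F \<dots> = ?F (\<lambda>z. complex_of_real a) + ?F (\<lambda>z. complex_of_real b * ?\<phi> z)
      + ?F (\<lambda>z. complex_of_real c * ?\<psi> z)"
    using C by (simp add: is_functional_calculus_add[OF \<Phi>] continuous_intros)
  also have "\<dots> = scale_op (complex_of_real a) + (scale_op (complex_of_real b) o\<^sub>L fun_of_op \<phi> A)
      + (scale_op (complex_of_real c) o\<^sub>L fun_of_op \<psi> A)"
    by (simp only: const is_functional_calculus_scale[OF \<Phi> C(1)]
        is_functional_calculus_scale[OF \<Phi> C(2)] fun_of_op_def)
  finally show ?thesis
    using x by (simp add: blinfun.add_left cinner_add_left cinner_scaleC_left cinner_self)
qed

lemma fun_of_op_ident:
  assumes \<Phi>: "is_functional_calculus A (functional_calculus A)" and real: "op_spectrum A \<subseteq> \<real>"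
  shows "fun_of_op (\<lambda>t. t) A = A"
proof -
  have "functional_calculus A (\<lambda>z. complex_of_real (Re z)) = functional_calculus A (\<lambda>z. z)"
    using real by (intro is_functional_calculus_cong[OF \<Phi>] continuous_intros)
      (auto elim: Reals_cases)
  then show ?thesis
    by (simp add: fun_of_op_def is_functional_calculus_ident[OF \<Phi>])
qed

subsection \<open>Jensen inequalities for positive functionals\<close>

text \<open>Along the chord from \<open>p\<close> to \<open>q\<close>, convexity bounds
  \<open>\<phi>\<close> by the linear interpolant, which tends to \<open>\<phi> p\<close> at
  \<open>p\<close>. The positive product says that \<open>u\<close> lies on the same side of
  \<open>p\<close> as \<open>q\<close>; this form also works at an endpoint of
  \<open>I\<close>.\<close>

lemma convex_on_less_on_side:
  fixes \<phi> :: "real \<Rightarrow> real"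
  assumes "convex_on I \<phi>" "p \<in> I" "q \<in> I" "p \<noteq> q" "\<phi> p < c"
  obtains d where "d > 0" "\<And>u. \<bar>u - p\<bar> < d \<Longrightarrow> 0 < (u - p) * (q - p) \<Longrightarrow> \<phi> u < c"
proof -
  have "((\<lambda>t. (1 - t) * \<phi> p + t * \<phi> q) \<longlongrightarrow> (1 - 0) * \<phi> p + 0 * \<phi> q) (at_right 0)"
    by (intro tendsto_intros)
  then have "\<forall>\<^sub>F t in at_right 0. (1 - t) * \<phi> p + t * \<phi> q < c"
    using assms(5) by (intro order_tendstoD(2)) auto
  then obtain b where b: "b > 0" "\<And>t. 0 < t \<Longrightarrow> t < b \<Longrightarrow> (1 - t) * \<phi> p + t * \<phi> q < c"
    by (auto simp: eventually_at_right[of 0 1])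
  show ?thesis
  proof
    \<comment> \<open>The bound 1 keeps \<open>u\<close> on the chord between \<open>p\<close> and
      \<open>q\<close>; the bound \<open>b\<close> keeps the interpolant below
      \<open>c\<close>.\<close>
    show "min 1 b * \<bar>q - p\<bar> > 0" using b(1) assms(4) by simp
    fix u assume u: "\<bar>u - p\<bar> < min 1 b * \<bar>q - p\<bar>" "0 < (u - p) * (q - p)"
    define t where "t = (u - p) / (q - p)"
    have t: "t > 0" "t < min 1 b"
    proof -
      show "t > 0" using u(2) by (simp add: t_def zero_less_mult_iff zero_less_divide_iff)
      then have "t = \<bar>u - p\<bar> / \<bar>q - p\<bar>" by (simp add: t_def flip: abs_divide)
      moreover have "\<bar>q - p\<bar> > 0" using assms(4) by simp
      ultimately show "t < min 1 b" using u(1) by (simp only: pos_divide_less_eq)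
    qed
    have "u = (1 - t) *\<^sub>R p + t *\<^sub>R q"
    proof -
      have "t * (q - p) = u - p" using assms(4) by (simp add: t_def)
      then show ?thesis by (simp add: algebra_simps)
    qed
    then have "\<phi> u \<le> (1 - t) * \<phi> p + t * \<phi> q"
      using convex_onD[OF assms(1), of t p q] t assms by simp
    also have "\<dots> < c" using b(2) t by simp
    finally show "\<phi> u < c" .
  qed
qed

lemma convex_on_upper_semicontinuous:
  fixes \<phi> :: "real \<Rightarrow> real"
  assumes "convex_on I \<phi>" "p \<in> I" "\<phi> p < c"
  obtains U where "open U" "p \<in> U" "\<And>u. u \<in> U \<inter> I \<Longrightarrow> \<phi> u < c"
proof -
  \<comment> \<open>The sign of \<open>s\<close> selects a side of \<open>p\<close>; if
    \<open>I\<close> has no point there, the claim is vacuous.\<close>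
  have side: "\<exists>d>0. \<forall>u\<in>I. \<bar>u - p\<bar> < d \<longrightarrow> 0 < (u - p) * s \<longrightarrow> \<phi> u < c" if "s \<noteq> 0" for s
  proof (cases "\<exists>q\<in>I. 0 < (q - p) * s")
    case True
    then obtain q where q: "q \<in> I" "0 < (q - p) * s" by blast
    then have "p \<noteq> q" by auto
    then obtain d where d: "d > 0" "\<And>u. \<bar>u - p\<bar> < d \<Longrightarrow> 0 < (u - p) * (q - p) \<Longrightarrow> \<phi> u < c"
      using convex_on_less_on_side[OF assms(1,2) q(1)] assms(3) by metis
    show ?thesis
      using d q(2) by (intro exI[of _ d]) (auto simp: zero_less_mult_iff)
  qed (auto intro: exI[of _ 1])
  obtain d d' where d: "d > 0" "\<forall>u\<in>I. \<bar>u - p\<bar> < d \<longrightarrow> 0 < (u - p) * 1 \<longrightarrow> \<phi> u < c"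
    and d': "d' > 0" "\<forall>u\<in>I. \<bar>u - p\<bar> < d' \<longrightarrow> 0 < (u - p) * (- 1) \<longrightarrow> \<phi> u < c"
    using side[of 1] side[of "- 1"] by auto
  show ?thesis
  proof
    show "p \<in> ball p (min d d')" using d d' by simp
    show "\<phi> u < c" if "u \<in> ball p (min d d') \<inter> I" for u
      using that d d' assms(3) by (cases u p rule: linorder_cases) (auto simp: dist_real_def)
  qed simp
qed

text \<open>\<open>g\<close> may jump at the left end of \<open>J2\<close>, and a convex function at an endpoint of \<open>J\<close>; but \<open>g \<circ> f\<close>
  is upper semicontinuous by its convexity and lower semicontinuous by the concavity of \<open>g\<close>.\<close>

lemma g_convex_on_continuous:
  assumes "g_convex_on g J J2 J3 f"
  shows "continuous_on J (g \<circ> f)"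
  unfolding continuous_on_def
proof (intro ballI order_tendstoI)
  fix p assume p: "p \<in> J"
  have "continuous_on J f" and fJ: "f ` J \<subseteq> J2" and g: "convex_on J2 (\<lambda>v. - g v)"
    using assms by (simp_all add: g_convex_on_def concave_on_def)
  then have f: "(f \<longlongrightarrow> f p) (at p within J)"
    using p by (simp add: continuous_on_def)
  show "\<forall>\<^sub>F u in at p within J. (g \<circ> f) u < c" if less: "(g \<circ> f) p < c" for c
  proof -
    have "convex_on J (g \<circ> f)" using assms by (simp add: g_convex_on_def)
    then obtain U where "open U" "p \<in> U" "\<And>u. u \<in> U \<inter> J \<Longrightarrow> (g \<circ> f) u < c"
      using p less by (rule convex_on_upper_semicontinuous) blast
    then show ?thesis
      unfolding eventually_at_topological by blast
  qed
  show "\<forall>\<^sub>F u in at p within J. c < (g \<circ> f) u" if "c < (g \<circ> f) p" for c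
  proof -
    have "f p \<in> J2" "- g (f p) < - c"
      using fJ p that by auto
    with g obtain U where U: "open U" "f p \<in> U" "\<And>v. v \<in> U \<inter> J2 \<Longrightarrow> - g v < - c"
      by (rule convex_on_upper_semicontinuous) blast
    have "\<forall>\<^sub>F u in at p within J. f u \<in> U"
      using topological_tendstoD[OF f U(1,2)] .
    moreover have "\<forall>\<^sub>F u in at p within J. u \<in> J"
      by (simp add: eventually_at_filter)
    ultimately show ?thesis
      by eventually_elim (use U(3) fJ in force)
  qed
qed

text \<open>Lying strictly between two points of \<open>I\<close> makes \<open>x\<close> an interior
  point. At an endpoint a supporting line may be vertical, as for \<open>- sqrt\<close> at
  0.\<close>

lemma convex_on_subgradient:
  fixes \<phi> :: "real \<Rightarrow> real"
  assumes "convex_on I \<phi>" "a \<in> I" "b \<in> I" "a < x" "x < b"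
  obtains m where "\<And>y. y \<in> I \<Longrightarrow> \<phi> x + m * (y - x) \<le> \<phi> y"
proof -
  have "{a<..<b} \<subseteq> I"
    using assms(2,3) convex_on_imp_convex[OF assms(1)]
    by (auto simp: is_interval_convex_1[symmetric] intro: mem_is_interval_1_I[of I a b])
  then have "x \<in> interior I"
    using assms(4,5) by (intro interiorI[of "{a<..<b}"]) auto
  then show ?thesis
    using convex_le_Inf_differential[OF assms(1)] by (intro that) auto
qed

text \<open>Both halves argue by contradiction with a
  supporting line at a point strictly between two points of the interval, so that the endpoints,
  where there may be no supporting line, cause no trouble.\<close>

lemma g_convex_jensen:
  fixes E :: "(real \<Rightarrow> real) \<Rightarrow> real"
  assumes conv: "g_convex_on g J J2 J3 f"
    and K: "compact K" "K \<noteq> {}" "K \<subseteq> J"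
    and E: "\<And>a b c \<phi> \<psi>. continuous_on K \<phi> \<Longrightarrow> continuous_on K \<psi> \<Longrightarrow>
      (\<And>t. t \<in> K \<Longrightarrow> 0 \<le> a + b * \<phi> t + c * \<psi> t) \<Longrightarrow> 0 \<le> a + b * E \<phi> + c * E \<psi>"
  shows "f (E (\<lambda>t. t)) \<le> inv_into J2 g (E (g \<circ> f))" and "inv_into J2 g (E (g \<circ> f)) \<le> E f"
proof -
  have J: "is_interval J" "is_interval J2" and f: "continuous_on J f" "f ` J \<subseteq> J2"
    and g: "strict_mono_on J2 g" "convex_on J2 (\<lambda>v. - g v)" and h: "convex_on J (g \<circ> f)"
    using conv by (auto simp: g_convex_on_def concave_on_def)
  have contJ: "continuous_on J (g \<circ> f)" using conv by (rule g_convex_on_continuous)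
  note cont = continuous_on_subset[OF f(1) K(3)] continuous_on_subset[OF contJ K(3)]
    continuous_on_id[of K]
  \<comment> \<open>Positivity puts \<open>E \<phi>\<close> between the extreme values of
    \<open>\<phi>\<close> on \<open>K\<close>. The intermediate value is taken on the interval
    \<open>J\<close>, because \<open>K\<close> may be disconnected.\<close>
  have mean: "E \<phi> \<in> \<phi> ` J" if \<phi>: "continuous_on J \<phi>" for \<phi>
  proof -
    have \<phi>K: "continuous_on K \<phi>" using \<phi> K(3) by (rule continuous_on_subset)
    obtain k l where k: "k \<in> K" "\<And>t. t \<in> K \<Longrightarrow> \<phi> k \<le> \<phi> t"
      and l: "l \<in> K" "\<And>t. t \<in> K \<Longrightarrow> \<phi> t \<le> \<phi> l"
      using continuous_attains_inf[OF K(1,2) \<phi>K] continuous_attains_sup[OF K(1,2) \<phi>K] by metis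
    have "\<phi> k \<le> E \<phi>" "E \<phi> \<le> \<phi> l"
      using E[OF \<phi>K \<phi>K, of "- \<phi> k" 1 0] E[OF \<phi>K \<phi>K, of "\<phi> l" "- 1" 0] k l by auto
    moreover have "is_interval (\<phi> ` J)"
      using J(1) \<phi> by (simp add: is_interval_connected_1 connected_continuous_image)
    ultimately show ?thesis
      using k(1) l(1) K(3) by (auto intro: mem_is_interval_1_I[of _ "\<phi> k" "\<phi> l"])
  qed
  define p where "p = E (\<lambda>t. t)"
  have p: "p \<in> J" using mean[of "\<lambda>t. t"] by (auto simp: p_def)
  obtain t where t: "t \<in> J" "E (g \<circ> f) = g (f t)" using mean[OF contJ] by auto
  have "f t \<in> J2" "f p \<in> J2" using f(2) t p by auto
  \<comment> \<open>Since \<open>E (g \<circ> f)\<close> is the value of \<open>g\<close> at a point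
    of \<open>J2\<close>, \<open>inv_into\<close> really is the inverse here.\<close>
  then have inv: "inv_into J2 g (E (g \<circ> f)) = f t"
    using g(1) by (simp add: t(2) strict_mono_on_imp_inj_on)
  have "(g \<circ> f) p \<le> (g \<circ> f) t"
  proof (rule ccontr)
    assume "\<not> ?thesis"
    then have less: "(g \<circ> f) t < (g \<circ> f) p" by simp
    have seg: "closed_segment t p \<subseteq> J"
      using J(1) t(1) p by (simp add: closed_segment_subset is_interval_convex)
    have "is_interval ((g \<circ> f) ` closed_segment t p)"
      using continuous_on_subset[OF contJ seg]
      by (simp only: is_interval_connected_1 connected_continuous_image connected_segment)
    \<comment> \<open>A point whose value lies halfway between those at \<open>t\<close> and
      \<open>p\<close> differs from both, hence is strictly between them.\<close>
    then have "((g \<circ> f) t + (g \<circ> f) p) / 2 \<in> (g \<circ> f) ` closed_segment t p"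
      by (rule mem_is_interval_1_I[of _ "(g \<circ> f) t" "(g \<circ> f) p"])
        (use less in \<open>simp_all del: comp_apply\<close>)
    then obtain r where r: "r \<in> closed_segment t p" "((g \<circ> f) t + (g \<circ> f) p) / 2 = (g \<circ> f) r"
      by (rule imageE)
    then have hr: "(g \<circ> f) t < (g \<circ> f) r" "(g \<circ> f) r < (g \<circ> f) p" using less by auto
    then have "r \<noteq> t" "r \<noteq> p" by auto
    then have between: "t < r \<and> r < p \<or> p < r \<and> r < t"
      using r(1) by (auto simp: closed_segment_eq_real_ivl split: if_splits)
    then obtain m where m: "\<And>u. u \<in> J \<Longrightarrow> (g \<circ> f) r + m * (u - r) \<le> (g \<circ> f) u"
      using convex_on_subgradient[OF h] t(1) p by metis
    have "m * (t - r) < 0" using m[OF t(1)] hr by simp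
    then have "m * (p - r) > 0" using between by (auto simp: mult_less_0_iff zero_less_mult_iff)
    \<comment> \<open>Applying \<open>E\<close> to the supporting line gives
      \<open>(g \<circ> f) r + m * (p - r) \<le> E (g \<circ> f)\<close>. With a positive increment
      the left side exceeds \<open>(g \<circ> f) t\<close>, which equals the right side.\<close>
    moreover have "0 \<le> - ((g \<circ> f) r - m * r) + (- m) * p + 1 * E (g \<circ> f)"
      unfolding p_def
    proof (rule E[OF cont(3,2)])
      fix u assume "u \<in> K"
      then show "0 \<le> - ((g \<circ> f) r - m * r) + (- m) * u + 1 * (g \<circ> f) u"
        using m[of u] K(3) by (auto simp: right_diff_distrib)
    qed
    ultimately show False using hr(1) t(2) by (simp add: algebra_simps)
  qed
  then show "f (E (\<lambda>t. t)) \<le> inv_into J2 g (E (g \<circ> f))"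
    unfolding inv p_def[symmetric]
    using strict_mono_onD[OF g(1) \<open>f t \<in> J2\<close> \<open>f p \<in> J2\<close>] by (auto simp: not_less[symmetric])
  have "f t \<le> E f"
  proof (rule ccontr)
    assume "\<not> ?thesis"
    then obtain s where s: "E f < s" "s < f t" using dense by (meson not_le)
    have "E f \<in> J2" using mean[OF f(1)] f(2) by auto
    then obtain m where m: "\<And>v. v \<in> J2 \<Longrightarrow> - g s + m * (v - s) \<le> - g v"
      using convex_on_subgradient[OF g(2) _ \<open>f t \<in> J2\<close> s] by metis
    have "s \<in> J2"
      using mem_is_interval_1_I[OF J(2) \<open>E f \<in> J2\<close> \<open>f t \<in> J2\<close>] s by simp
    then have "g s < g (f t)" "g (E f) < g s"
      using strict_mono_onD[OF g(1)] \<open>f t \<in> J2\<close> \<open>E f \<in> J2\<close> s by auto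
    then have "m * (f t - s) < 0" using m[OF \<open>f t \<in> J2\<close>] by simp
    then have "m * (E f - s) > 0" using s by (simp add: mult_less_0_iff zero_less_mult_iff)
    \<comment> \<open>The line lying above \<open>g\<close> and touching it at \<open>s\<close>
      yields \<open>E (g \<circ> f) \<le> g s - m * (E f - s) < g s\<close>, whereas
      \<open>E (g \<circ> f) = g (f t) > g s\<close>.\<close>
    moreover have "0 \<le> (g s + m * s) + (- m) * E f + (- 1) * E (g \<circ> f)"
    proof (rule E[OF cont(1,2)])
      fix u assume "u \<in> K"
      then have "f u \<in> J2" using K(3) f(2) by auto
      from m[OF this] show "0 \<le> (g s + m * s) + (- m) * f u + (- 1) * (g \<circ> f) u"
        by (simp add: right_diff_distrib)
    qed
    ultimately show False using \<open>g s < g (f t)\<close> t(2) by (simp add: algebra_simps)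
  qed
  then show "inv_into J2 g (E (g \<circ> f)) \<le> E f" by (simp add: inv)
qed

subsection \<open>The inequality for operators\<close>

theorem proposition4p1:
  fixes f g :: "real \<Rightarrow> real" and J J2 J3 :: "real set"
    and A :: "'a::chilbert_space \<Rightarrow>\<^sub>L 'a" and x :: 'a
  assumes "g_convex_on g J J2 J3 f"
    and "A \<in> bounded_ops" and "self_adjoint A"
    and "op_spectrum A \<subseteq> complex_of_real ` J"
    and "norm x = 1"
  shows "f (Re (cinner (blinfun_apply A x) x))
           \<le> inv_into J2 g (Re (cinner (blinfun_apply (fun_of_op (g \<circ> f) A) x) x))
       \<and> inv_into J2 g (Re (cinner (blinfun_apply (fun_of_op (g \<circ> f) A) x) x))
           \<le> Re (cinner (blinfun_apply (fun_of_op f A) x) x)"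
proof -
  \<comment> \<open>As \<open>fun_of_op\<close> precomposes with \<open>Re\<close>, continuity and
    sign conditions on the spectrum become conditions on this set of real numbers.\<close>
  define K where "K = Re ` op_spectrum A"
  define E where "E \<phi> = Re (cinner (blinfun_apply (fun_of_op \<phi> A) x) x)" for \<phi>
  have real: "op_spectrum A \<subseteq> \<real>" using assms(4) by (auto simp: Reals_def)
  have \<Phi>: "is_functional_calculus A (functional_calculus A)"
    using assms(2,3) real by (rule is_functional_calculus_functional_calculus)
  have "compact K"
    unfolding K_def using compact_op_spectrum[OF assms(2)]
    by (intro compact_continuous_image continuous_intros)
  moreover have "K \<noteq> {}"
    using op_spectrum_nonempty[OF assms(3,5)] by (simp add: K_def)
  moreover have "K \<subseteq> J"
    using assms(4) by (auto simp: K_def)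
  moreover have "0 \<le> a + b * E \<phi> + c * E \<psi>"
    if "continuous_on K \<phi>" "continuous_on K \<psi>" "\<And>t. t \<in> K \<Longrightarrow> 0 \<le> a + b * \<phi> t + c * \<psi> t"
    for a b c \<phi> \<psi>
    unfolding E_def
    by (intro fun_of_op_affine_nonneg[OF \<Phi> assms(5)] continuous_on_compose2[OF that(1)]
        continuous_on_compose2[OF that(2)] continuous_intros that(3)) (auto simp: K_def)
  ultimately have "f (E (\<lambda>t. t)) \<le> inv_into J2 g (E (g \<circ> f))" "inv_into J2 g (E (g \<circ> f)) \<le> E f"
    using g_convex_jensen[OF assms(1), of K E] by blast+
  then show ?thesis
    by (simp add: E_def fun_of_op_ident[OF \<Phi> real])
qed

end
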